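(* Let $(S;\wedge,\vee,1)$ be a co-strongly distributive skew lattice with top $1$. Then a binary operation $\rightarrow$ can be defined on $S$ making $(S;\wedge,\vee,\rightarrow,1)$ a skew Heyting algebra if and only if a binary operation $\rightarrow$ can be defined on $S/\mathcal D$ making $(S/\mathcal D;\wedge,\vee,\rightarrow,\mathcal D_1)$ a generalized Heyting algebra, where $S/\mathcal D$ carries the quotient operations and $\mathcal D_1$ is the $\mathcal D$-class of $1$.
   Context: A skew lattice is an algebra $(S;\wedge,\vee)$ of type $(2,2)$ in which $\wedge$ and $\vee$ are idempotent and associative and satisfy $x\wedge(x\vee y)=x=x\vee(x\wedge y)$ and $(x\wedge y)\vee y=y=(x\vee y)\wedge y$. Its natural partial order is: $x\le y$ iff $x\vee y=y=y\vee x$. Its natural preorder is: $x\preceq y$ iff $y\vee x\vee y=y$ (equivalently $x\wedge y\wedge x=x$). Green's relation $\mathcal D$ is: $x\mathrel{\mathcal D}y$ iff $x\preceq y$ and $y\preceq x$. It is known that $\mathcal D$ is a congruence on any skew lattice $S$ and that $S/\mathcal D$ is a lattice (the maximal lattice image of $S$). A skew lattice with top is $(S;\wedge,\vee,1)$ with $x\vee 1=1=1\vee x$ for all $x$. A skew lattice is co-strongly distributive if $x\vee(y\wedge z)=(x\vee y)\wedge(x\vee z)$ and $(x\wedge y)\vee z=(x\vee z)\wedge(y\vee z)$ for all $x,y,z$. For $u\in S$ put $u{\uparrow}=\{x\in S: u\le x\}$; if $S$ is co-strongly distributive with top $1$, then $u{\uparrow}$ is closed under $\wedge,\vee$ and is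 a (commutative) bounded distributive lattice with bottom $u$ and top $1$. A generalized Heyting algebra is an algebra $(A;\wedge,\vee,\rightarrow,1)$ such that $(A;\wedge,\vee,1)$ is a distributive lattice with top $1$ and $x\wedge y\le z$ iff $x\le y\rightarrow z$ for all $x,y,z$. A Heyting algebra is a generalized Heyting algebra that also has a bottom. A skew Heyting lattice is a co-strongly distributive skew lattice $(S;\wedge,\vee,1)$ with top $1$ such that for each $u\in S$ there is an operation $\rightarrow_u$ on $u{\uparrow}$ making $(u{\uparrow};\wedge,\vee,\rightarrow_u,1,u)$ a Heyting algebra (such $\rightarrow_u$ is unique). A skew Heyting algebra is an algebra $(S;\wedge,\vee,\rightarrow,1)$ of type $(2,2,2,0)$ such that $(S;\wedge,\vee,1)$ is a skew Heyting lattice and $x\rightarrow y=(y\vee x\vee y)\rightarrow_y y$ for all $x,y\in S$. *)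

theory Defs
  imports Main
begin

section \<open>Skew lattices\<close>

locale skew_lattice =
  fixes S :: "'a set"
    and meet :: "'a \<Rightarrow> 'a \<Rightarrow> 'a" (infixl "\<sqinter>" 70)
    and join :: "'a \<Rightarrow> 'a \<Rightarrow> 'a" (infixl "\<squnion>" 65)
  assumes meet_closed: "\<lbrakk>x \<in> S; y \<in> S\<rbrakk> \<Longrightarrow> x \<sqinter> y \<in> S"
    and join_closed: "\<lbrakk>x \<in> S; y \<in> S\<rbrakk> \<Longrightarrow> x \<squnion> y \<in> S"
    and meet_idem: "x \<in> S \<Longrightarrow> x \<sqinter> x = x"
    and join_idem: "x \<in> S \<Longrightarrow> x \<squnion> x = x"
    and meet_assoc: "\<lbrakk>x \<in> S; y \<in> S; z \<in> S\<rbrakk> \<Longrightarrow> (x \<sqinter> y) \<sqinter> z = x \<sqinter> (y \<sqinter> z)"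
    and join_assoc: "\<lbrakk>x \<in> S; y \<in> S; z \<in> S\<rbrakk> \<Longrightarrow> (x \<squnion> y) \<squnion> z = x \<squnion> (y \<squnion> z)"
    and meet_absorb_left: "\<lbrakk>x \<in> S; y \<in> S\<rbrakk> \<Longrightarrow> x \<sqinter> (x \<squnion> y) = x"
    and join_absorb_left: "\<lbrakk>x \<in> S; y \<in> S\<rbrakk> \<Longrightarrow> x \<squnion> (x \<sqinter> y) = x"
    and join_absorb_right: "\<lbrakk>x \<in> S; y \<in> S\<rbrakk> \<Longrightarrow> (x \<sqinter> y) \<squnion> y = y"
    and meet_absorb_right: "\<lbrakk>x \<in> S; y \<in> S\<rbrakk> \<Longrightarrow> (x \<squnion> y) \<sqinter> y = y"

locale skew_lattice_top = skew_lattice +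
  fixes one :: 'a
  assumes one_closed: "one \<in> S"
    and join_one: "x \<in> S \<Longrightarrow> x \<squnion> one = one"
    and one_join: "x \<in> S \<Longrightarrow> one \<squnion> x = one"

locale co_strongly_distributive_skew_lattice_top = skew_lattice_top +
  assumes join_meet_distrib:
      "\<lbrakk>x \<in> S; y \<in> S; z \<in> S\<rbrakk> \<Longrightarrow> x \<squnion> (y \<sqinter> z) = (x \<squnion> y) \<sqinter> (x \<squnion> z)"
    and meet_join_distrib:
      "\<lbrakk>x \<in> S; y \<in> S; z \<in> S\<rbrakk> \<Longrightarrow> (x \<sqinter> y) \<squnion> z = (x \<squnion> z) \<sqinter> (y \<squnion> z)"

definition natural_le :: "('a \<Rightarrow> 'a \<Rightarrow> 'a) \<Rightarrow> 'a \<Rightarrow> 'a \<Rightarrow> bool" where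
  "natural_le join x y \<longleftrightarrow> join x y = y \<and> join y x = y"

definition natural_preorder :: "('a \<Rightarrow> 'a \<Rightarrow> 'a) \<Rightarrow> 'a \<Rightarrow> 'a \<Rightarrow> bool" where
  "natural_preorder join x y \<longleftrightarrow> join (join y x) y = y"

definition upset :: "'a set \<Rightarrow> ('a \<Rightarrow> 'a \<Rightarrow> 'a) \<Rightarrow> 'a \<Rightarrow> 'a set" where
  "upset S join u = {x \<in> S. natural_le join u x}"


section \<open>The maximal lattice image\<close>

definition green_D :: "'a set \<Rightarrow> ('a \<Rightarrow> 'a \<Rightarrow> 'a) \<Rightarrow> ('a \<times> 'a) set" where
  "green_D S join =
     {(x, y). x \<in> S \<and> y \<in> S \<and> natural_preorder join x y \<and> natural_preorder join y x}"

text \<open>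
  When the equivalence relation \<open>r\<close> is a congruence for \<open>f\<close>, all the classes in the union
  coincide (see \<open>UN_equiv_class2\<close>), so this is the operation sending the classes of \<open>x\<close>
  and \<open>y\<close> to the class of \<open>f x y\<close>.
\<close>

definition quotient_op ::
    "('a \<times> 'a) set \<Rightarrow> ('a \<Rightarrow> 'a \<Rightarrow> 'a) \<Rightarrow> 'a set \<Rightarrow> 'a set \<Rightarrow> 'a set" where
  "quotient_op r f X Y = (\<Union>x\<in>X. \<Union>y\<in>Y. r `` {f x y})"


section \<open>Heyting algebras on a carrier set\<close>

locale distributive_lattice_top =
  fixes A :: "'a set"
    and meet :: "'a \<Rightarrow> 'a \<Rightarrow> 'a" (infixl "\<sqinter>" 70)
    and join :: "'a \<Rightarrow> 'a \<Rightarrow> 'a" (infixl "\<squnion>" 65)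
    and one :: 'a
  assumes meet_closed: "\<lbrakk>x \<in> A; y \<in> A\<rbrakk> \<Longrightarrow> x \<sqinter> y \<in> A"
    and join_closed: "\<lbrakk>x \<in> A; y \<in> A\<rbrakk> \<Longrightarrow> x \<squnion> y \<in> A"
    and meet_assoc: "\<lbrakk>x \<in> A; y \<in> A; z \<in> A\<rbrakk> \<Longrightarrow> (x \<sqinter> y) \<sqinter> z = x \<sqinter> (y \<sqinter> z)"
    and join_assoc: "\<lbrakk>x \<in> A; y \<in> A; z \<in> A\<rbrakk> \<Longrightarrow> (x \<squnion> y) \<squnion> z = x \<squnion> (y \<squnion> z)"
    and meet_commute: "\<lbrakk>x \<in> A; y \<in> A\<rbrakk> \<Longrightarrow> x \<sqinter> y = y \<sqinter> x"
    and join_commute: "\<lbrakk>x \<in> A; y \<in> A\<rbrakk> \<Longrightarrow> x \<squnion> y = y \<squnion> x"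
    and meet_absorb: "\<lbrakk>x \<in> A; y \<in> A\<rbrakk> \<Longrightarrow> x \<sqinter> (x \<squnion> y) = x"
    and join_absorb: "\<lbrakk>x \<in> A; y \<in> A\<rbrakk> \<Longrightarrow> x \<squnion> (x \<sqinter> y) = x"
    and distrib: "\<lbrakk>x \<in> A; y \<in> A; z \<in> A\<rbrakk> \<Longrightarrow> x \<sqinter> (y \<squnion> z) = (x \<sqinter> y) \<squnion> (x \<sqinter> z)"
    and one_closed: "one \<in> A"
    and le_one: "x \<in> A \<Longrightarrow> natural_le join x one"

locale generalized_heyting_algebra = distributive_lattice_top +
  fixes imp :: "'a \<Rightarrow> 'a \<Rightarrow> 'a" (infixr "\<leadsto>" 60)
  assumes imp_closed: "\<lbrakk>x \<in> A; y \<in> A\<rbrakk> \<Longrightarrow> x \<leadsto> y \<in> A"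
    and residuation:
      "\<lbrakk>x \<in> A; y \<in> A; z \<in> A\<rbrakk> \<Longrightarrow>
         natural_le join (x \<sqinter> y) z \<longleftrightarrow> natural_le join x (y \<leadsto> z)"

locale heyting_algebra = generalized_heyting_algebra +
  fixes bottom :: 'a
  assumes bottom_closed: "bottom \<in> A"
    and bottom_le: "x \<in> A \<Longrightarrow> natural_le join bottom x"


section \<open>Skew Heyting algebras\<close>

locale skew_heyting_lattice = co_strongly_distributive_skew_lattice_top +
  assumes heyting_upsets:
    "u \<in> S \<Longrightarrow> \<exists>h. heyting_algebra (upset S join u) meet join one h u"

text \<open>
  The operation \<open>h\<close> below is determined on \<open>y\<up>\<close> by the residuation law, so it is the
  operation \<open>\<rightarrow>\<^sub>y\<close>; only its values outside \<open>y\<up>\<close> are arbitrary.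
\<close>

locale skew_heyting_algebra = skew_heyting_lattice +
  fixes imp :: "'a \<Rightarrow> 'a \<Rightarrow> 'a" (infixr "\<leadsto>" 60)
  assumes imp_closed: "\<lbrakk>x \<in> S; y \<in> S\<rbrakk> \<Longrightarrow> x \<leadsto> y \<in> S"
    and imp_eq:
      "\<lbrakk>x \<in> S; y \<in> S\<rbrakk> \<Longrightarrow>
         \<exists>h. heyting_algebra (upset S join y) meet join one h y \<and>
             x \<leadsto> y = h (y \<squnion> x \<squnion> y) y"

end

(*
  In a band the preorder x <= y iff yxy = y makes the product xy a least upper bound of x and y.
  Applied to the join and, dually, to the meet, this shows that S/D is a lattice, ordered by the
  natural preorder. For each u the class map restricts to an isomorphism from the upset of u onto
  the principal filter of S/D generated by the class of u, with inverse induced by x |-> u v x v u.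
  A distributive lattice has all implications y -> z as soon as it has those with z <= y, which
  are computed in the filter generated by z; so the implications of the upsets and an implication
  on S/D determine each other.
*)
theory Submission
  imports Defs
begin

section \<open>Bands and their natural preorder\<close>

locale band =
  fixes S :: "'a set"
    and f :: "'a \<Rightarrow> 'a \<Rightarrow> 'a" (infixl "\<cdot>" 70)
  assumes closed: "\<lbrakk>x \<in> S; y \<in> S\<rbrakk> \<Longrightarrow> x \<cdot> y \<in> S"
    and idem: "x \<in> S \<Longrightarrow> x \<cdot> x = x"
    and assoc: "\<lbrakk>x \<in> S; y \<in> S; z \<in> S\<rbrakk> \<Longrightarrow> (x \<cdot> y) \<cdot> z = x \<cdot> (y \<cdot> z)"
begin

lemma left_idem: "\<lbrakk>x \<in> S; y \<in> S\<rbrakk> \<Longrightarrow> x \<cdot> (x \<cdot> y) = x \<cdot> y"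
  by (metis assoc idem)

text \<open>A factorisation of \<open>y\<close> through \<open>x\<close> suffices: absorbing the
  repeated \<open>x \<cdot> b\<close> gives \<open>y = y \<cdot> (x \<cdot> b) \<cdot> y\<close>,
  and idempotence of \<open>y \<cdot> x\<close> then turns this into
  \<open>y \<cdot> x \<cdot> y = y\<close>. Exhibiting such a factorisation is the standard way to
  prove preorder facts below.\<close>

lemma natural_preorderI:
  assumes S: "a \<in> S" "x \<in> S" "b \<in> S" and y: "y = a \<cdot> x \<cdot> b"
  shows "natural_preorder f x y"
proof -
  have yS: "y \<in> S" using S y by (simp add: closed)
  have "y \<cdot> (x \<cdot> b) \<cdot> y = a \<cdot> (x \<cdot> b) \<cdot> (x \<cdot> b) \<cdot> y"
    using S y by (simp add: assoc closed)
  also have "\<dots> = y"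
    using S y yS by (metis assoc closed idem)
  finally have y': "y = y \<cdot> x \<cdot> (b \<cdot> y)"
    using S yS by (simp add: assoc closed)
  have "y \<cdot> x \<cdot> y = y \<cdot> x \<cdot> (y \<cdot> x \<cdot> (b \<cdot> y))"
    using y' by simp
  also have "\<dots> = (y \<cdot> x) \<cdot> (b \<cdot> y)"
    using S yS by (simp add: closed left_idem assoc[of "y \<cdot> x" "y \<cdot> x" "b \<cdot> y", symmetric] idem)
  finally show ?thesis
    using y' by (simp add: natural_preorder_def)
qed

lemma natural_preorder_refl: "x \<in> S \<Longrightarrow> natural_preorder f x x"
  by (simp add: natural_preorder_def idem)

lemma natural_preorder_trans:
  assumes S: "x \<in> S" "y \<in> S" "z \<in> S"
    and xy: "natural_preorder f x y" and yz: "natural_preorder f y z"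
  shows "natural_preorder f x z"
proof (rule natural_preorderI)
  have "z = z \<cdot> (y \<cdot> x \<cdot> y) \<cdot> z"
    using xy yz by (simp add: natural_preorder_def)
  also have "\<dots> = (z \<cdot> y) \<cdot> x \<cdot> (y \<cdot> z)"
    using S by (simp add: assoc closed)
  finally show "z = (z \<cdot> y) \<cdot> x \<cdot> (y \<cdot> z)" .
qed (use S in \<open>simp_all add: closed\<close>)

lemma natural_preorder_left:
  assumes "x \<in> S" "y \<in> S" shows "natural_preorder f x (x \<cdot> y)"
  by (rule natural_preorderI[of x x y]) (use assms in \<open>simp_all add: idem\<close>)

lemma natural_preorder_right:
  assumes "x \<in> S" "y \<in> S" shows "natural_preorder f y (x \<cdot> y)"
  by (rule natural_preorderI[of x y y]) (use assms in \<open>simp_all add: assoc idem\<close>)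

text \<open>The square of \<open>y \<cdot> x\<close> contains \<open>x \<cdot> y\<close> as its
  middle factor. By symmetry, products commute up to equivalence.\<close>

lemma natural_preorder_swap:
  assumes "x \<in> S" "y \<in> S" shows "natural_preorder f (x \<cdot> y) (y \<cdot> x)"
proof (rule natural_preorderI[of y _ x])
  show "y \<cdot> x = y \<cdot> (x \<cdot> y) \<cdot> x"
    using assms by (metis assoc closed idem)
qed (use assms in \<open>simp_all add: closed\<close>)

text \<open>Both \<open>p \<cdot> y \<cdot> p\<close> and \<open>p \<cdot> x \<cdot> p\<close> equal
  \<open>p\<close>, so multiplying them factors \<open>p\<close> through
  \<open>y \<cdot> p \<cdot> x\<close>. The unwanted \<open>p\<close> between \<open>y\<close> and
  \<open>x\<close> is moved to the front by swapping the factors \<open>y\<close> and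
  \<open>p \<cdot> x\<close>; the result \<open>p \<cdot> x \<cdot> y\<close> is a multiple of
  \<open>x \<cdot> y\<close>, and transitivity closes the chain.\<close>

lemma natural_preorder_least:
  assumes S: "x \<in> S" "y \<in> S" "p \<in> S"
    and xp: "natural_preorder f x p" and yp: "natural_preorder f y p"
  shows "natural_preorder f (x \<cdot> y) p"
proof -
  have "p = (p \<cdot> y \<cdot> p) \<cdot> (p \<cdot> x \<cdot> p)"
    using S xp yp by (simp add: natural_preorder_def idem)
  also have "\<dots> = p \<cdot> (y \<cdot> (p \<cdot> x)) \<cdot> p"
    using S by (simp add: assoc closed left_idem)
  finally have 1: "natural_preorder f (y \<cdot> (p \<cdot> x)) p"
    using S by (intro natural_preorderI[of p _ p]) (simp_all add: closed)
  have 2: "natural_preorder f (p \<cdot> x \<cdot> y) (y \<cdot> (p \<cdot> x))"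
    using S by (intro natural_preorder_swap) (simp_all add: closed)
  have 3: "natural_preorder f (x \<cdot> y) (p \<cdot> x \<cdot> y)"
    using S natural_preorder_right[of p "x \<cdot> y"] by (simp add: assoc closed)
  show ?thesis
    using natural_preorder_trans[OF _ _ _ 3 natural_preorder_trans[OF _ _ _ 2 1]] S
    by (simp add: closed)
qed

lemma natural_preorder_lub_iff:
  assumes "x \<in> S" "y \<in> S" "p \<in> S"
  shows "natural_preorder f (x \<cdot> y) p \<longleftrightarrow> natural_preorder f x p \<and> natural_preorder f y p"
  using assms natural_preorder_least[of x y p] natural_preorder_left[of x y]
    natural_preorder_right[of x y] natural_preorder_trans[of x "x \<cdot> y" p]
    natural_preorder_trans[of y "x \<cdot> y" p] closed[of x y] by blast

end

text \<open>Co-strong distributivity provides the law of join over meet, whereas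
  \<open>distributive_lattice_top\<close> asks for meet over join. In a lattice the former yields
  the latter: expand \<open>(x \<sqinter> y) \<squnion> (x \<sqinter> z)\<close> and absorb. The
  rule serves both the quotient and the upsets.\<close>

lemma distributive_lattice_topI:
  fixes meet :: "'a \<Rightarrow> 'a \<Rightarrow> 'a" (infixl "\<sqinter>" 70)
    and join :: "'a \<Rightarrow> 'a \<Rightarrow> 'a" (infixl "\<squnion>" 65)
  assumes mc: "\<And>x y. \<lbrakk>x \<in> A; y \<in> A\<rbrakk> \<Longrightarrow> x \<sqinter> y \<in> A"
    and jc: "\<And>x y. \<lbrakk>x \<in> A; y \<in> A\<rbrakk> \<Longrightarrow> x \<squnion> y \<in> A"
    and ma: "\<And>x y z. \<lbrakk>x \<in> A; y \<in> A; z \<in> A\<rbrakk> \<Longrightarrow> (x \<sqinter> y) \<sqinter> z = x \<sqinter> (y \<sqinter> z)"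
    and ja: "\<And>x y z. \<lbrakk>x \<in> A; y \<in> A; z \<in> A\<rbrakk> \<Longrightarrow> (x \<squnion> y) \<squnion> z = x \<squnion> (y \<squnion> z)"
    and mcomm: "\<And>x y. \<lbrakk>x \<in> A; y \<in> A\<rbrakk> \<Longrightarrow> x \<sqinter> y = y \<sqinter> x"
    and jcomm: "\<And>x y. \<lbrakk>x \<in> A; y \<in> A\<rbrakk> \<Longrightarrow> x \<squnion> y = y \<squnion> x"
    and mabs: "\<And>x y. \<lbrakk>x \<in> A; y \<in> A\<rbrakk> \<Longrightarrow> x \<sqinter> (x \<squnion> y) = x"
    and jabs: "\<And>x y. \<lbrakk>x \<in> A; y \<in> A\<rbrakk> \<Longrightarrow> x \<squnion> (x \<sqinter> y) = x"
    and jm: "\<And>x y z. \<lbrakk>x \<in> A; y \<in> A; z \<in> A\<rbrakk> \<Longrightarrow> x \<squnion> (y \<sqinter> z) = (x \<squnion> y) \<sqinter> (x \<squnion> z)"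
    and one: "one \<in> A" "\<And>x. x \<in> A \<Longrightarrow> natural_le join x one"
  shows "distributive_lattice_top A meet join one"
proof (unfold_locales; (fact assms)?)
  fix x y z assume A: "x \<in> A" "y \<in> A" "z \<in> A"
  have "(x \<sqinter> y) \<squnion> (x \<sqinter> z) = ((x \<sqinter> y) \<squnion> x) \<sqinter> ((x \<sqinter> y) \<squnion> z)"
    using A by (simp add: jm mc)
  also have "(x \<sqinter> y) \<squnion> x = x"
    using A by (simp add: jcomm[of "x \<sqinter> y" x] mc jabs)
  also have "(x \<sqinter> y) \<squnion> z = (x \<squnion> z) \<sqinter> (y \<squnion> z)"
    using A by (simp add: jcomm[of _ z] mc jm)
  also have "x \<sqinter> ((x \<squnion> z) \<sqinter> (y \<squnion> z)) = x \<sqinter> (y \<squnion> z)"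
    using A by (simp add: ma[symmetric] jc mabs)
  finally show "x \<sqinter> (y \<squnion> z) = (x \<sqinter> y) \<squnion> (x \<sqinter> z)" ..
qed

section \<open>Skew lattices: the preorder seen from join and meet, and the quotient by
  \<open>D\<close>\<close>

context skew_lattice
begin

sublocale joins: band S join
  by unfold_locales (simp_all add: join_closed join_idem join_assoc)

sublocale meets: band S meet
  by unfold_locales (simp_all add: meet_closed meet_idem meet_assoc)

abbreviation preorder (infix "\<preceq>" 50) where "x \<preceq> y \<equiv> natural_preorder join x y"

abbreviation D where "D \<equiv> green_D S join"

text \<open>If \<open>y \<squnion> x \<squnion> y = y\<close>, absorption gives
  \<open>(y \<squnion> x) \<sqinter> y = y \<squnion> x\<close>; since also
  \<open>(y \<squnion> x) \<sqinter> x = x\<close>, the element \<open>x\<close> factors through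
  \<open>y\<close> in the meet band. The converse is dual. Hence every band fact about the meet can
  be read as a fact about \<open>\<preceq>\<close> with the order reversed.\<close>

lemma natural_preorder_meet:
  assumes S: "x \<in> S" "y \<in> S"
  shows "natural_preorder meet y x \<longleftrightarrow> x \<preceq> y"
proof
  assume "x \<preceq> y"
  then have y: "(y \<squnion> x) \<squnion> y = y"
    by (simp add: natural_preorder_def)
  have "(y \<squnion> x) \<sqinter> y = y \<squnion> x"
    using meet_absorb_left[of "y \<squnion> x" y] S y by (simp add: join_closed)
  then have "x = (y \<squnion> x) \<sqinter> y \<sqinter> x"
    using S by (simp add: meet_absorb_right)
  then show "natural_preorder meet y x"
    using S by (intro meets.natural_preorderI[of "y \<squnion> x" y x]) (simp_all add: join_closed)
next
  assume "natural_preorder meet y x"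
  then have x: "(x \<sqinter> y) \<sqinter> x = x"
    by (simp add: natural_preorder_def)
  have "(x \<sqinter> y) \<squnion> x = x \<sqinter> y"
    using join_absorb_left[of "x \<sqinter> y" x] S x by (simp add: meet_closed)
  then have "y = (x \<sqinter> y) \<squnion> x \<squnion> y"
    using S by (simp add: join_absorb_right)
  then show "x \<preceq> y"
    using S by (intro joins.natural_preorderI[of "x \<sqinter> y" x y]) (simp_all add: meet_closed)
qed

lemma join_preorder_iff:
  "\<lbrakk>x \<in> S; y \<in> S; z \<in> S\<rbrakk> \<Longrightarrow> x \<squnion> y \<preceq> z \<longleftrightarrow> x \<preceq> z \<and> y \<preceq> z"
  by (rule joins.natural_preorder_lub_iff)

text \<open>Least upper bounds in the meet band become greatest lower bounds for
  \<open>\<preceq>\<close>, because the two preorders are opposite.\<close>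

lemma preorder_meet_iff:
  assumes "x \<in> S" "y \<in> S" "z \<in> S"
  shows "z \<preceq> x \<sqinter> y \<longleftrightarrow> z \<preceq> x \<and> z \<preceq> y"
  using meets.natural_preorder_lub_iff[OF assms] assms
  by (simp add: natural_preorder_meet meet_closed)

lemma preorder_join: "\<lbrakk>x \<in> S; y \<in> S\<rbrakk> \<Longrightarrow> x \<preceq> x \<squnion> y" "\<lbrakk>x \<in> S; y \<in> S\<rbrakk> \<Longrightarrow> y \<preceq> x \<squnion> y"
  by (simp_all add: joins.natural_preorder_left joins.natural_preorder_right)

lemma meet_preorder: "\<lbrakk>x \<in> S; y \<in> S\<rbrakk> \<Longrightarrow> x \<sqinter> y \<preceq> x" "\<lbrakk>x \<in> S; y \<in> S\<rbrakk> \<Longrightarrow> x \<sqinter> y \<preceq> y"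
  using preorder_meet_iff[of x y "x \<sqinter> y"]
  by (simp_all add: meet_closed joins.natural_preorder_refl)

lemma join_mono:
  assumes "x \<in> S" "y \<in> S" "x' \<in> S" "y' \<in> S" "x \<preceq> x'" "y \<preceq> y'"
  shows "x \<squnion> y \<preceq> x' \<squnion> y'"
  using assms preorder_join[of x' y'] joins.natural_preorder_trans[of x x' "x' \<squnion> y'"]
    joins.natural_preorder_trans[of y y' "x' \<squnion> y'"]
  by (simp add: join_preorder_iff join_closed)

lemma meet_mono:
  assumes "x \<in> S" "y \<in> S" "x' \<in> S" "y' \<in> S" "x \<preceq> x'" "y \<preceq> y'"
  shows "x \<sqinter> y \<preceq> x' \<sqinter> y'"
  using assms meet_preorder[of x y] joins.natural_preorder_trans[of "x \<sqinter> y" x x']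
    joins.natural_preorder_trans[of "x \<sqinter> y" y y']
  by (simp add: preorder_meet_iff meet_closed)

lemma D_iff: "(x, y) \<in> D \<longleftrightarrow> x \<in> S \<and> y \<in> S \<and> x \<preceq> y \<and> y \<preceq> x"
  by (simp add: green_D_def)

lemma equiv_D: "equiv S D"
proof (rule equivI)
  show "D \<subseteq> S \<times> S" by (auto simp: green_D_def)
  show "refl_on S D" by (auto simp: refl_on_def D_iff joins.natural_preorder_refl)
  show "sym D" by (auto simp: sym_def D_iff)
  show "trans D" unfolding trans_def D_iff using joins.natural_preorder_trans by blast
qed

lemma class_eq_iff:
  "\<lbrakk>x \<in> S; y \<in> S\<rbrakk> \<Longrightarrow> D `` {x} = D `` {y} \<longleftrightarrow> x \<preceq> y \<and> y \<preceq> x"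
  using eq_equiv_class_iff[OF equiv_D] by (simp add: D_iff)

lemma class_in_quotient: "x \<in> S \<Longrightarrow> D `` {x} \<in> S // D"
  by (rule quotientI)

text \<open>Monotonicity of the meet makes \<open>D\<close> a congruence for it, so all classes in
  the union defining \<open>quotient_op\<close> coincide.\<close>

lemma quotient_meet:
  assumes "x \<in> S" "y \<in> S"
  shows "quotient_op D meet (D `` {x}) (D `` {y}) = D `` {x \<sqinter> y}"
  unfolding quotient_op_def
proof (rule UN_equiv_class2[OF equiv_D equiv_D _ assms])
  show "congruent2 D D (\<lambda>x y. D `` {x \<sqinter> y})"
  proof (rule congruent2I')
    fix a a' b b' assume "(a, a') \<in> D" "(b, b') \<in> D"
    then show "D `` {a \<sqinter> b} = D `` {a' \<sqinter> b'}"
      unfolding D_iff using meet_mono[of a b a' b'] meet_mono[of a' b' a b]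
      by (simp add: class_eq_iff meet_closed)
  qed
qed

lemma quotient_join:
  assumes "x \<in> S" "y \<in> S"
  shows "quotient_op D join (D `` {x}) (D `` {y}) = D `` {x \<squnion> y}"
  unfolding quotient_op_def
proof (rule UN_equiv_class2[OF equiv_D equiv_D _ assms])
  show "congruent2 D D (\<lambda>x y. D `` {x \<squnion> y})"
  proof (rule congruent2I')
    fix a a' b b' assume "(a, a') \<in> D" "(b, b') \<in> D"
    then show "D `` {a \<squnion> b} = D `` {a' \<squnion> b'}"
      unfolding D_iff using join_mono[of a b a' b'] join_mono[of a' b' a b]
      by (simp add: class_eq_iff join_closed)
  qed
qed

text \<open>Equality of the classes of \<open>x \<squnion> y\<close> and \<open>y\<close> amounts to
  \<open>x \<squnion> y \<preceq> y\<close>, which by the least upper bound property is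
  \<open>x \<preceq> y\<close>. From here on inequalities between classes are computed with
  representatives.\<close>

lemma quotient_le_iff:
  assumes "x \<in> S" "y \<in> S"
  shows "natural_le (quotient_op D join) (D `` {x}) (D `` {y}) \<longleftrightarrow> x \<preceq> y"
  using assms
  by (auto simp: natural_le_def quotient_join class_eq_iff join_closed join_preorder_iff
      preorder_join joins.natural_preorder_refl)

end

section \<open>The quotient as a distributive lattice with top\<close>

context co_strongly_distributive_skew_lattice_top
begin

abbreviation up where "up u \<equiv> upset S join u"

lemma up_iff: "x \<in> up u \<longleftrightarrow> x \<in> S \<and> u \<squnion> x = x \<and> x \<squnion> u = x"
  by (simp add: upset_def natural_le_def)

lemma preorder_of_up: "\<lbrakk>u \<in> S; x \<in> up u\<rbrakk> \<Longrightarrow> u \<preceq> x"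
  by (simp add: up_iff natural_preorder_def join_idem)

text \<open>Associativity, absorption, distributivity and the top law descend from \<open>S\<close>
  through representatives. Commutativity is what the quotient adds: it holds because meets and joins
  are greatest lower and least upper bounds for \<open>\<preceq>\<close>.\<close>

lemma quotient_distributive_lattice_top:
  "distributive_lattice_top (S // D) (quotient_op D meet) (quotient_op D join) (D `` {one})"
proof (rule distributive_lattice_topI)
  fix X Y Z assume "X \<in> S // D" "Y \<in> S // D" "Z \<in> S // D"
  then obtain x y z where "x \<in> S" "y \<in> S" "z \<in> S" "X = D `` {x}" "Y = D `` {y}" "Z = D `` {z}"
    by (auto elim!: quotientE)
  then show
    "quotient_op D meet (quotient_op D meet X Y) Z = quotient_op D meet X (quotient_op D meet Y Z)"
    "quotient_op D join (quotient_op D join X Y) Z = quotient_op D join X (quotient_op D join Y Z)"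
    "quotient_op D join X (quotient_op D meet Y Z) =
     quotient_op D meet (quotient_op D join X Y) (quotient_op D join X Z)"
    by (simp_all add: quotient_meet quotient_join meet_closed join_closed meet_assoc join_assoc
        join_meet_distrib)
next
  fix X Y assume "X \<in> S // D" "Y \<in> S // D"
  then obtain x y where "x \<in> S" "y \<in> S" "X = D `` {x}" "Y = D `` {y}"
    by (auto elim!: quotientE)
  then show "quotient_op D meet X Y \<in> S // D" "quotient_op D join X Y \<in> S // D"
    "quotient_op D meet X Y = quotient_op D meet Y X"
    "quotient_op D join X Y = quotient_op D join Y X"
    "quotient_op D meet X (quotient_op D join X Y) = X"
    "quotient_op D join X (quotient_op D meet X Y) = X"
    by (simp_all add: quotient_meet quotient_join meet_closed join_closed class_in_quotient
        class_eq_iff preorder_meet_iff meet_preorder join_preorder_iff preorder_join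
        meet_absorb_left join_absorb_left)
next
  fix X assume "X \<in> S // D"
  then obtain x where "x \<in> S" "X = D `` {x}"
    by (auto elim!: quotientE)
  then show "natural_le (quotient_op D join) X (D `` {one})"
    by (simp add: natural_le_def quotient_join one_closed join_one one_join)
qed (simp add: class_in_quotient one_closed)

section \<open>Upsets: their lattice structure and the retraction onto them\<close>

context
  fixes u assumes u: "u \<in> S"
begin

lemma up_join_closed: "\<lbrakk>x \<in> up u; y \<in> up u\<rbrakk> \<Longrightarrow> x \<squnion> y \<in> up u"
  using u by (metis up_iff join_assoc join_closed)

lemma up_meet_closed: "\<lbrakk>x \<in> up u; y \<in> up u\<rbrakk> \<Longrightarrow> x \<sqinter> y \<in> up u"
  using u by (simp add: up_iff meet_closed join_meet_distrib meet_join_distrib)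

text \<open>The common lower bound \<open>u\<close> lets distributivity act: writing
  \<open>x\<close> as \<open>x \<squnion> u\<close> gives \<open>(x \<squnion> y) \<sqinter> x = x
  \<squnion> (y \<sqinter> u) = x\<close>, and writing it as \<open>u \<squnion> x\<close> gives
  \<open>x \<sqinter> (y \<squnion> x) = x\<close>. By absorption
  \<open>x \<squnion> y \<squnion> x\<close> equals both \<open>x \<squnion> y\<close> and
  \<open>y \<squnion> x\<close>.\<close>

lemma up_join_commute:
  assumes "x \<in> up u" "y \<in> up u" shows "x \<squnion> y = y \<squnion> x"
proof -
  have S: "x \<in> S" "y \<in> S" and x: "u \<squnion> x = x" "x \<squnion> u = x" and y: "u \<squnion> y = y" "y \<squnion> u = y"
    using assms by (simp_all add: up_iff)
  have yu: "y \<sqinter> u = u" and uy: "u \<sqinter> y = u"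
    using meet_absorb_right[of y u] meet_absorb_left[of u y] u S y by simp_all
  have "(x \<squnion> y) \<sqinter> x = x"
    using join_meet_distrib[of x y u] u S x yu by simp
  then have 1: "x \<squnion> y \<squnion> x = x \<squnion> y"
    using join_absorb_left[of "x \<squnion> y" x] S by (simp add: join_closed)
  have "x \<sqinter> (y \<squnion> x) = x"
    using meet_join_distrib[of u y x] u S x uy by simp
  then have "x \<squnion> (y \<squnion> x) = y \<squnion> x"
    using join_absorb_right[of x "y \<squnion> x"] S by (simp add: join_closed)
  with 1 show ?thesis
    using S by (simp add: join_assoc)
qed

lemma up_meet_commute:
  assumes x: "x \<in> up u" and y: "y \<in> up u" shows "x \<sqinter> y = y \<sqinter> x"
proof -
  \<comment> \<open>Commuting joins let each one-sided absorption law be used on the other side as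
    well. The two identities then make \<open>x \<sqinter> y \<sqinter> x\<close> equal to both
    \<open>x \<sqinter> y\<close> and \<open>y \<sqinter> x\<close>.\<close>
  have meet_left: "a \<sqinter> (b \<sqinter> a) = b \<sqinter> a" and meet_right: "(a \<sqinter> b) \<sqinter> a = a \<sqinter> b"
    if a: "a \<in> up u" and b: "b \<in> up u" for a b
  proof -
    have S: "a \<in> S" "b \<in> S" using a b by (simp_all add: up_iff)
    have "a \<squnion> (b \<sqinter> a) = a"
      using up_join_commute[OF a up_meet_closed[OF b a]] S by (simp add: join_absorb_right)
    then show "a \<sqinter> (b \<sqinter> a) = b \<sqinter> a"
      using meet_absorb_right[of a "b \<sqinter> a"] S by (simp add: meet_closed)
    have "(a \<sqinter> b) \<squnion> a = a"
      using up_join_commute[OF a up_meet_closed[OF a b]] S by (simp add: join_absorb_left)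
    then show "(a \<sqinter> b) \<sqinter> a = a \<sqinter> b"
      using meet_absorb_left[of "a \<sqinter> b" a] S by (simp add: meet_closed)
  qed
  have S: "x \<in> S" "y \<in> S" using x y by (simp_all add: up_iff)
  have "x \<sqinter> y = (x \<sqinter> y) \<sqinter> x"
    using meet_right[OF x y] by simp
  also have "\<dots> = x \<sqinter> (y \<sqinter> x)"
    using S by (simp add: meet_assoc)
  finally show ?thesis
    using meet_left[OF x y] by simp
qed

text \<open>With commuting joins, \<open>y \<squnion> x \<squnion> y\<close> collapses to
  \<open>y \<squnion> x\<close>. So the class map is an order embedding on each upset.\<close>

lemma up_le_iff:
  assumes x: "x \<in> up u" and y: "y \<in> up u"
  shows "natural_le join x y \<longleftrightarrow> x \<preceq> y"
proof -
  have S: "x \<in> S" "y \<in> S" using x y by (simp_all add: up_iff)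
  have "(y \<squnion> x) \<squnion> y = y \<squnion> x"
    using up_join_commute[OF x y] S by (metis join_assoc join_idem)
  then show ?thesis
    using up_join_commute[OF x y] by (auto simp: natural_le_def natural_preorder_def)
qed

lemma up_distributive_lattice_top: "distributive_lattice_top (up u) meet join one"
proof (rule distributive_lattice_topI)
  show "natural_le join x one" if "x \<in> up u" for x
    using that by (simp add: natural_le_def up_iff join_one one_join)
  show "(x \<sqinter> y) \<sqinter> z = x \<sqinter> (y \<sqinter> z)" "(x \<squnion> y) \<squnion> z = x \<squnion> (y \<squnion> z)"
    "x \<squnion> (y \<sqinter> z) = (x \<squnion> y) \<sqinter> (x \<squnion> z)"
    if "x \<in> up u" "y \<in> up u" "z \<in> up u" for x y z
    using that by (simp_all add: up_iff meet_assoc join_assoc join_meet_distrib)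
  show "x \<sqinter> (x \<squnion> y) = x" "x \<squnion> (x \<sqinter> y) = x" if "x \<in> up u" "y \<in> up u" for x y
    using that by (simp_all add: up_iff meet_absorb_left join_absorb_left)
  show "one \<in> up u"
    using u by (simp add: up_iff one_closed join_one one_join)
qed (simp_all add: up_meet_closed up_join_closed, simp_all add: up_meet_commute up_join_commute)

lemma retract_in_up: "x \<in> S \<Longrightarrow> u \<squnion> x \<squnion> u \<in> up u"
  using u by (simp add: up_iff join_closed joins.left_idem join_assoc join_idem)

text \<open>Up to equivalence the retract is the join of \<open>x\<close> and \<open>u\<close>, and
  \<open>u\<close> is already below \<open>z\<close>.\<close>

lemma retract_preorder_iff:
  "\<lbrakk>x \<in> S; z \<in> S; u \<preceq> z\<rbrakk> \<Longrightarrow> u \<squnion> x \<squnion> u \<preceq> z \<longleftrightarrow> x \<preceq> z"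
  using u by (simp add: join_preorder_iff join_closed)

text \<open>An element \<open>x\<close> with \<open>u \<preceq> x\<close> is equivalent to its
  retract, which is therefore a representative of the class of \<open>x\<close> inside the upset of
  \<open>u\<close>.\<close>

lemma preorder_retract_iff:
  assumes "x \<in> S" "z \<in> S" "u \<preceq> x"
  shows "z \<preceq> u \<squnion> x \<squnion> u \<longleftrightarrow> z \<preceq> x"
proof -
  have "u \<squnion> x \<squnion> u \<preceq> x"
    using retract_preorder_iff[of x x] assms by (simp add: joins.natural_preorder_refl)
  moreover have "x \<preceq> u \<squnion> x \<squnion> u"
    using preorder_join u assms(1) join_preorder_iff[of u x "u \<squnion> x \<squnion> u"] by (simp add: join_closed)
  ultimately show ?thesis
    using joins.natural_preorder_trans[of z "u \<squnion> x \<squnion> u" x]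
      joins.natural_preorder_trans[of z x "u \<squnion> x \<squnion> u"] assms u
    by (auto simp: join_closed)
qed

end

section \<open>Transfer of implications between the upsets and the quotient\<close>

lemma generalized_heyting_quotient_of_upsets:
  assumes upsets: "\<And>u. u \<in> S \<Longrightarrow> heyting_algebra (up u) meet join one (h u) u"
  shows "\<exists>imp. generalized_heyting_algebra (S // D) (quotient_op D meet) (quotient_op D join)
    (D `` {one}) imp"
proof -
  define rep where "rep X = (SOME x. x \<in> S \<and> D `` {x} = X)" for X
  have rep: "rep X \<in> S" "D `` {rep X} = X" if "X \<in> S // D" for X
    using that someI_ex[of "\<lambda>x. x \<in> S \<and> D `` {x} = X"]
    by (auto simp: rep_def elim!: quotientE)
  \<comment> \<open>This is the implication that \<open>imp_eq\<close> prescribes for a skew Heyting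
    algebra.\<close>
  define g where "g x y = h y (y \<squnion> x \<squnion> y) y" for x y
  have g_up: "g x y \<in> up y" if "x \<in> S" "y \<in> S" for x y
  proof -
    interpret H: heyting_algebra "up y" meet join one "h y" y
      using upsets that by blast
    show ?thesis
      unfolding g_def using that by (intro H.imp_closed retract_in_up H.bottom_closed)
  qed
  \<comment> \<open>Residuation for the preorder on all of \<open>S\<close>: \<open>a\<close> and
    \<open>x\<close> are retracted into the upset of \<open>y\<close>, where \<open>h y\<close>
    residuates.\<close>
  have residuation: "a \<sqinter> x \<preceq> y \<longleftrightarrow> a \<preceq> g x y" if S: "a \<in> S" "x \<in> S" "y \<in> S" for a x y
  proof -
    interpret H: heyting_algebra "up y" meet join one "h y" y
      using upsets S by blast
    let ?a = "y \<squnion> a \<squnion> y" and ?x = "y \<squnion> x \<squnion> y"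
    have up: "?a \<in> up y" "?x \<in> up y" "y \<in> up y" "g x y \<in> up y"
      using S by (simp_all add: retract_in_up H.bottom_closed g_up)
    \<comment> \<open>Both co-strong distributive laws together say that the retraction preserves
      meets.\<close>
    have "?a \<sqinter> ?x = y \<squnion> (a \<sqinter> x) \<squnion> y"
      using S by (simp add: join_meet_distrib meet_join_distrib meet_closed join_closed)
    then have "a \<sqinter> x \<preceq> y \<longleftrightarrow> ?a \<sqinter> ?x \<preceq> y"
      using S by (simp add: retract_preorder_iff meet_closed joins.natural_preorder_refl)
    also have "\<dots> \<longleftrightarrow> natural_le join ?a (g x y)"
      using S up H.residuation[of ?a ?x y]
      by (simp add: g_def up_le_iff[of y, symmetric] H.meet_closed)
    \<comment> \<open>Since \<open>g x y\<close> lies above \<open>y\<close>, the retract of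
      \<open>a\<close> may be replaced by \<open>a\<close> itself.\<close>
    also have "\<dots> \<longleftrightarrow> a \<preceq> g x y"
      using S up preorder_of_up[of y "g x y"]
      by (simp add: up_le_iff[of y] retract_preorder_iff up_iff[of "g x y"])
    finally show ?thesis .
  qed
  interpret Q: distributive_lattice_top
    "S // D" "quotient_op D meet" "quotient_op D join" "D `` {one}"
    by (rule quotient_distributive_lattice_top)
  \<comment> \<open>Evaluating \<open>g\<close> at the chosen representatives gives a function of
    the classes outright.\<close>
  have "generalized_heyting_algebra (S // D) (quotient_op D meet) (quotient_op D join)
    (D `` {one}) (\<lambda>X Y. D `` {g (rep X) (rep Y)})"
  proof unfold_locales
    fix X Y assume X: "X \<in> S // D" and Y: "Y \<in> S // D"
    have gS: "g (rep X) (rep Y) \<in> S"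
      using g_up[of "rep X" "rep Y"] rep X Y by (simp add: up_iff)
    then show "D `` {g (rep X) (rep Y)} \<in> S // D"
      by (rule class_in_quotient)
    fix Z assume Z: "Z \<in> S // D"
    have "natural_le (quotient_op D join)
        (quotient_op D meet (D `` {rep Z}) (D `` {rep X})) (D `` {rep Y}) \<longleftrightarrow>
      natural_le (quotient_op D join) (D `` {rep Z}) (D `` {g (rep X) (rep Y)})"
      using rep(1)[OF X] rep(1)[OF Y] rep(1)[OF Z] gS
      by (simp add: quotient_meet quotient_le_iff meet_closed residuation)
    then show "natural_le (quotient_op D join) (quotient_op D meet Z X) Y \<longleftrightarrow>
      natural_le (quotient_op D join) Z (D `` {g (rep X) (rep Y)})"
      by (simp add: rep(2) X Y Z)
  qed
  then show ?thesis by blast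
qed

lemma heyting_upset_of_quotient:
  assumes imp: "generalized_heyting_algebra (S // D) (quotient_op D meet) (quotient_op D join)
      (D `` {one}) imp"
    and u: "u \<in> S"
  shows "\<exists>h. heyting_algebra (up u) meet join one h u"
proof -
  interpret Q: generalized_heyting_algebra
    "S // D" "quotient_op D meet" "quotient_op D join" "D `` {one}" imp
    by (rule imp)
  \<comment> \<open>A lift of the quotient implication to \<open>S\<close>. Its value need not lie
    in a given upset, so it is retracted to \<open>u \<squnion> r x y \<squnion> u\<close>
    below.\<close>
  define r where "r x y = (SOME z. z \<in> S \<and> D `` {z} = imp (D `` {x}) (D `` {y}))" for x y
  have r: "r x y \<in> S" "D `` {r x y} = imp (D `` {x}) (D `` {y})" if "x \<in> S" "y \<in> S" for x y
  proof -
    have "imp (D `` {x}) (D `` {y}) \<in> S // D"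
      using that by (simp add: Q.imp_closed class_in_quotient)
    then have "\<exists>z. z \<in> S \<and> D `` {z} = imp (D `` {x}) (D `` {y})"
      by (auto elim!: quotientE)
    from someI_ex[OF this]
    show "r x y \<in> S" "D `` {r x y} = imp (D `` {x}) (D `` {y})"
      by (simp_all add: r_def)
  qed
  have residuation: "a \<sqinter> x \<preceq> y \<longleftrightarrow> a \<preceq> r x y" if S: "a \<in> S" "x \<in> S" "y \<in> S" for a x y
    using Q.residuation[of "D `` {a}" "D `` {x}" "D `` {y}"] S
    by (simp add: r(2)[symmetric] r(1) class_in_quotient quotient_meet quotient_le_iff meet_closed)
  interpret U: distributive_lattice_top "up u" meet join one
    by (rule up_distributive_lattice_top[OF u])
  have "heyting_algebra (up u) meet join one (\<lambda>x y. u \<squnion> r x y \<squnion> u) u"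
  proof unfold_locales
    fix x y assume x: "x \<in> up u" and y: "y \<in> up u"
    then have S: "x \<in> S" "y \<in> S" by (simp_all add: up_iff)
    show up: "u \<squnion> r x y \<squnion> u \<in> up u"
      using u S r by (simp add: retract_in_up)
    fix z assume z: "z \<in> up u"
    then have zS: "z \<in> S" by (simp add: up_iff)
    \<comment> \<open>As \<open>u \<sqinter> x \<preceq> u \<preceq> y\<close>, residuation puts
      \<open>u\<close> below \<open>r x y\<close>; this is the condition under which retracting
      leaves the class of \<open>r x y\<close> unchanged.\<close>
    have "u \<sqinter> x \<preceq> y"
      using meet_preorder(1)[of u x] preorder_of_up[OF u y] u S
        joins.natural_preorder_trans[of "u \<sqinter> x" u y] by (simp add: meet_closed)
    then have "u \<preceq> r x y"
      using residuation u S by simp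
    then show "natural_le join (z \<sqinter> x) y \<longleftrightarrow> natural_le join z (u \<squnion> r x y \<squnion> u)"
      using u x y z S zS up r
      by (simp add: up_le_iff[of u] U.meet_closed residuation preorder_retract_iff)
  next
    show "u \<in> up u" using u by (simp add: up_iff join_idem)
    show "natural_le join u x" if "x \<in> up u" for x
      using that by (simp add: upset_def)
  qed
  then show ?thesis by blast
qed

lemma skew_heyting_algebra_of_upsets:
  assumes upsets: "\<And>u. u \<in> S \<Longrightarrow> heyting_algebra (up u) meet join one (h u) u"
  shows "skew_heyting_algebra S meet join one (\<lambda>x y. h y (y \<squnion> x \<squnion> y) y)"
proof unfold_locales
  show "\<exists>h. heyting_algebra (up u) meet join one h u" if "u \<in> S" for u
    using upsets that by blast
next
  fix x y assume S: "x \<in> S" "y \<in> S"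
  interpret H: heyting_algebra "up y" meet join one "h y" y
    using upsets S by blast
  have "h y (y \<squnion> x \<squnion> y) y \<in> up y"
    using S by (intro H.imp_closed retract_in_up H.bottom_closed)
  then show "h y (y \<squnion> x \<squnion> y) y \<in> S"
    by (simp add: up_iff)
  show "\<exists>k. heyting_algebra (up y) meet join one k y \<and>
      h y (y \<squnion> x \<squnion> y) y = k (y \<squnion> x \<squnion> y) y"
    using upsets S by blast
qed

end

theorem theorem3p5:
  fixes S :: "'a set"
    and meet join :: "'a \<Rightarrow> 'a \<Rightarrow> 'a"
    and one :: 'a
  assumes "co_strongly_distributive_skew_lattice_top S meet join one"
  shows "(\<exists>imp. skew_heyting_algebra S meet join one imp) \<longleftrightarrow>
         (\<exists>imp. generalized_heyting_algebra
                  (S // green_D S join)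
                  (quotient_op (green_D S join) meet)
                  (quotient_op (green_D S join) join)
                  (green_D S join `` {one})
                  imp)"
proof -
  interpret co_strongly_distributive_skew_lattice_top S meet join one
    by (rule assms)
  show ?thesis
  proof
    assume "\<exists>imp. skew_heyting_algebra S meet join one imp"
    then have "skew_heyting_lattice S meet join one"
      by (auto simp: skew_heyting_algebra_def)
    \<comment> \<open>One Heyting implication is chosen for each upset, giving a family
      \<open>h\<close> indexed by the bottom element.\<close>
    then obtain h where "\<And>u. u \<in> S \<Longrightarrow> heyting_algebra (up u) meet join one (h u) u"
      using skew_heyting_lattice.heyting_upsets by metis
    then show "\<exists>imp. generalized_heyting_algebra (S // D) (quotient_op D meet)
        (quotient_op D join) (D `` {one}) imp"
      by (rule generalized_heyting_quotient_of_upsets)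
  next
    assume "\<exists>imp. generalized_heyting_algebra (S // D) (quotient_op D meet)
        (quotient_op D join) (D `` {one}) imp"
    then obtain h where "\<And>u. u \<in> S \<Longrightarrow> heyting_algebra (up u) meet join one (h u) u"
      using heyting_upset_of_quotient by metis
    then show "\<exists>imp. skew_heyting_algebra S meet join one imp"
      using skew_heyting_algebra_of_upsets by blast
  qed
qed

end
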